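(* For every $m>0$ and every $\beta_0>0$ there exists a unique $\beta_\infty>0$ (depending on $m$ and $\beta_0$), and this $\beta_\infty$ satisfies $\beta_\infty>\beta_0$, such that with $$B=-\frac{4(\beta_0+\beta_\infty)}{m(m+2)}<0,\qquad C=\frac{2\left(\beta_0(m+1)^2+\beta_\infty\right)}{m(m+2)}>0,\qquad p(\gamma)=B\frac{\gamma^2}{2}+C,$$ there exists a smooth solution $v:[1,m+1]\to\mathbb{R}$ of the boundary value problem $$v'(\gamma)=2\sqrt2\,\sqrt{v(\gamma)}+p(\gamma)\gamma\quad(\gamma\in[1,m+1]),\qquad v(1)=2,\quad v(m+1)=2(m+1)^2 .$$ For this $\beta_\infty$ the smooth solution $v$ is unique, and it also satisfies $$v'(1)=2(\beta_0+2),\qquad v'(m+1)=-2(m+1)(\beta_\infty-2),\qquad v(\gamma)>2\gamma^2\ \text{ for all }\gamma\in(1,m+1).$$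
   Context: A solution $v$ is understood to be non-negative, so that $\sqrt{v}$ makes sense. At the endpoints of $[1,m+1]$ derivatives are one-sided. *)

theory Defs
  imports "HOL-Analysis.Analysis"
begin

(* D n is the n-th derivative of f on S. On {a..b} with a < b, differentiation
   within S is two-sided in the interior and one-sided at the endpoints, so
   smooth_on_set f {a..b} says that f is C-infinity on the closed interval;
   the values of f outside S are irrelevant. *)
definition smooth_on_set :: "(real \<Rightarrow> real) \<Rightarrow> real set \<Rightarrow> bool" where
  "smooth_on_set f S \<longleftrightarrow>
     (\<exists>D :: nat \<Rightarrow> real \<Rightarrow> real.
        (\<forall>x\<in>S. D 0 x = f x) \<and>
        (\<forall>n. \<forall>x\<in>S. (D n has_real_derivative D (Suc n) x) (at x within S)))"

definition coeff_B :: "real \<Rightarrow> real \<Rightarrow> real \<Rightarrow> real" where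
  "coeff_B m \<beta>0 \<beta>inf = - (4 * (\<beta>0 + \<beta>inf)) / (m * (m + 2))"

definition coeff_C :: "real \<Rightarrow> real \<Rightarrow> real \<Rightarrow> real" where
  "coeff_C m \<beta>0 \<beta>inf = 2 * (\<beta>0 * (m + 1)\<^sup>2 + \<beta>inf) / (m * (m + 2))"

definition p_fun :: "real \<Rightarrow> real \<Rightarrow> real \<Rightarrow> real \<Rightarrow> real" where
  "p_fun m \<beta>0 \<beta>inf \<gamma> = coeff_B m \<beta>0 \<beta>inf * (\<gamma>\<^sup>2 / 2) + coeff_C m \<beta>0 \<beta>inf"

(* Nonnegativity is part of being a solution: HOL's sqrt is total (odd), so the
   equation alone would not exclude negative values of v. *)
definition smooth_bvp_solution ::
    "real \<Rightarrow> real \<Rightarrow> real \<Rightarrow> (real \<Rightarrow> real) \<Rightarrow> bool" where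
  "smooth_bvp_solution m \<beta>0 \<beta>inf v \<longleftrightarrow>
     smooth_on_set v {1..m + 1} \<and>
     (\<forall>\<gamma>\<in>{1..m + 1}. 0 \<le> v \<gamma>) \<and>
     (\<forall>\<gamma>\<in>{1..m + 1}.
        (v has_real_derivative (2 * sqrt 2 * sqrt (v \<gamma>) + p_fun m \<beta>0 \<beta>inf \<gamma> * \<gamma>))
          (at \<gamma> within {1..m + 1})) \<and>
     v 1 = 2 \<and>
     v (m + 1) = 2 * (m + 1)\<^sup>2"

end

theory Submission
  imports Defs
begin

text \<open>
  Put $d = v - 2\gamma^2$. Rationalising the difference of square roots gives
  $d' = a\,d + p(\gamma)\,\gamma$ with $a = 2\sqrt2/(\sqrt v + \sqrt2\,\gamma) > 0$, and $p$
  decreases from $2\beta_0$ at $1$ to $-2\beta_\infty$ at $m+1$. With the integrating factor $E$,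
  $(dE)' = p\,\gamma\,E$, so $dE$ first increases and then decreases; as $d$ vanishes at both
  ends it is positive in between. Since $E$ is strictly decreasing, comparison of $dE$ with
  $E(z)\int p\,\gamma$, where $z$ is the zero of $p$, forces $\beta_\infty > \beta_0$.
  Uniqueness of $\beta_\infty$ and $v$ follows by the same device applied to the difference of two
  solutions, because $p$ is strictly decreasing in $\beta_\infty$.
  Existence is a shooting argument: $d(m+1)$ depends continuously on $\beta_\infty$, is positive
  for $\beta_\infty = \beta_0$ and negative for $\beta_\infty = \beta_0(m+1)$.
\<close>

section \<open>Monotonicity from one-sided derivatives, and integrating factors\<close>

text \<open>The sign condition concerns only the open interval because the derivatives met later,
  such as \<open>p \<beta> t * t * (E t - E z)\<close>, vanish at an end point. Derivatives within
  \<open>{l..u}\<close> are two-sided there; at the ends continuity suffices.\<close>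

lemma increasing_within:
  fixes f f' :: "real \<Rightarrow> real"
  assumes "a < b" "{a..b} \<subseteq> {l..u}"
    and der: "\<And>t. t \<in> {l..u} \<Longrightarrow> (f has_real_derivative f' t) (at t within {l..u})"
    and pos: "\<And>t. a < t \<Longrightarrow> t < b \<Longrightarrow> f' t > 0"
  shows "f a < f b"
proof (rule DERIV_pos_imp_increasing_open[OF assms(1)])
  have sub: "l \<le> a" "b \<le> u"
    using assms(1,2) by auto
  show "\<exists>y. (f has_real_derivative y) (at t) \<and> 0 < y" if "a < t" "t < b" for t
    using der[of t] pos[of t] that sub at_within_Icc_at[of l t u] by auto
  show "continuous_on {a..b} f"
    using assms(2) der DERIV_continuous_on continuous_on_subset by blast
qed

lemma decreasing_within:
  fixes f f' :: "real \<Rightarrow> real"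
  assumes "a < b" "{a..b} \<subseteq> {l..u}"
    and der: "\<And>t. t \<in> {l..u} \<Longrightarrow> (f has_real_derivative f' t) (at t within {l..u})"
    and neg: "\<And>t. a < t \<Longrightarrow> t < b \<Longrightarrow> f' t < 0"
  shows "f b < f a"
  using increasing_within[OF assms(1,2), of "\<lambda>t. - f t" "\<lambda>t. - f' t"] der neg
  by (auto intro: DERIV_minus)

lemma nondecreasing_within:
  fixes f f' :: "real \<Rightarrow> real"
  assumes "a \<le> b" "{a..b} \<subseteq> {l..u}"
    and der: "\<And>t. t \<in> {l..u} \<Longrightarrow> (f has_real_derivative f' t) (at t within {l..u})"
    and nonneg: "\<And>t. a < t \<Longrightarrow> t < b \<Longrightarrow> f' t \<ge> 0"
  shows "f a \<le> f b"
proof (cases "a = b")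
  case False
  show ?thesis
  proof (rule DERIV_nonneg_imp_increasing_open[OF assms(1)])
    have sub: "l \<le> a" "b \<le> u"
      using assms(1,2) by auto
    show "\<exists>y. (f has_real_derivative y) (at t) \<and> 0 \<le> y" if "a < t" "t < b" for t
      using der[of t] nonneg[of t] that sub at_within_Icc_at[of l t u] by auto
    show "continuous_on {a..b} f"
      using assms(2) der DERIV_continuous_on continuous_on_subset by blast
  qed
qed simp

lemma integrating_factor:
  fixes a :: "real \<Rightarrow> real"
  assumes "continuous_on {l..u} a"
  obtains E where "E l = 1" "\<And>t. 0 < E t"
    "\<And>t. t \<in> {l..u} \<Longrightarrow> (E has_real_derivative - a t * E t) (at t within {l..u})"
proof -
  define E where "E t = exp (- integral {l..t} a)" for t
  show ?thesis
  proof
    show "E l = 1" "\<And>t. 0 < E t"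
      by (auto simp: E_def)
    show "(E has_real_derivative - a t * E t) (at t within {l..u})" if "t \<in> {l..u}" for t
      unfolding E_def using integral_has_real_derivative[OF assms that]
      by (auto intro!: derivative_eq_intros)
  qed
qed

text \<open>The terms in \<open>a\<close> cancel in the product rule, so the monotonicity of
  \<open>e t * E t\<close> is decided by the sign of \<open>g\<close> alone when \<open>E\<close> is
  positive.\<close>

lemma integrating_factor_deriv:
  fixes e E :: "real \<Rightarrow> real"
  assumes "(E has_real_derivative - a * E t) (at t within S)"
    and "(e has_real_derivative a * e t + g) (at t within S)"
  shows "((\<lambda>t. e t * E t) has_real_derivative g * E t) (at t within S)"
  by (rule DERIV_cong[OF DERIV_mult[OF assms(2,1)]]) (simp add: algebra_simps)

section \<open>Existence and continuous dependence for Lipschitz equations\<close>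

text \<open>Banach's fixed point theorem, applied to bounded continuous functions. The global
  Lipschitz condition gives a solution on all of \<open>{l..u}\<close>, without continuation of
  local ones.\<close>

lemma picard_solution:
  fixes f :: "real \<Rightarrow> real \<Rightarrow> real"
  assumes "l \<le> u" "L > 0"
    and cont: "continuous_on ({l..u} \<times> UNIV) (\<lambda>(t, y). f t y)"
    and lip: "\<And>t x y. t \<in> {l..u} \<Longrightarrow> \<bar>f t x - f t y\<bar> \<le> L * \<bar>x - y\<bar>"
  obtains y where "y l = y0"
    "\<And>t. t \<in> {l..u} \<Longrightarrow> (y has_real_derivative f t (y t)) (at t within {l..u})"
proof -
  \<comment> \<open>The exponential weight makes the Picard operator a contraction on the whole interval at once.\<close>
  define w where "w t = exp (2 * L * (t - l))" for t
  define J where "J y t = y0 + integral {l..t} (\<lambda>s. f s (y s))" for y t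
  \<comment> \<open>Elements of \<open>bcontfun\<close> live on the whole real line, so arguments
    are clamped to \<open>{l..u}\<close>.\<close>
  define \<tau> where "\<tau> t = max l (min u t)" for t
  have \<tau>: "\<tau> t \<in> {l..u}" for t
    using \<open>l \<le> u\<close> by (auto simp: \<tau>_def)
  have [simp]: "\<tau> t = t" if "t \<in> {l..u}" for t
    using that by (auto simp: \<tau>_def)
  \<comment> \<open>The Picard operator \<open>J\<close> conjugated by multiplication with
    \<open>w\<close>; its fixed point is the solution divided by \<open>w\<close>.\<close>
  define g where "g v t = J (\<lambda>s. w s * apply_bcontfun v s) (\<tau> t) / w (\<tau> t)" for v t
  have fcont: "continuous_on {l..u} (\<lambda>s. f s (y s))" if "continuous_on {l..u} y" for y
  proof -
    have "continuous_on {l..u} ((\<lambda>(t, y). f t y) \<circ> (\<lambda>s. (s, y s)))"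
      by (rule continuous_on_compose, intro continuous_intros that)
         (rule continuous_on_subset[OF cont], auto)
    then show ?thesis by (simp add: o_def)
  qed
  have wcont: "continuous_on S w" for S
    unfolding w_def by (intro continuous_intros)
  have wpos: "w t > 0" for t by (simp add: w_def)
  have fwcont: "continuous_on {l..u} (\<lambda>s. f s (w s * apply_bcontfun v s))" for v
    by (intro fcont continuous_intros wcont continuous_on_apply_bcontfun)
  have Jder: "(J y has_real_derivative f t (y t)) (at t within {l..u})"
    if "continuous_on {l..u} y" "t \<in> {l..u}" for y t
    unfolding J_def using integral_has_real_derivative[OF fcont[OF that(1)] that(2)]
    by (auto intro!: derivative_eq_intros)
  have gcont: "g v \<in> bcontfun" for v
  proof -
    let ?k = "\<lambda>t. J (\<lambda>s. w s * apply_bcontfun v s) t / w t"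
    have kc: "continuous_on {l..u} ?k"
      using wpos by (intro continuous_intros wcont DERIV_continuous_on[OF Jder] continuous_on_apply_bcontfun)
        (auto simp: less_imp_neq[symmetric])
    have \<tau>c: "continuous_on UNIV \<tau>"
      unfolding \<tau>_def by (intro continuous_intros)
    have "continuous_on UNIV (?k \<circ> \<tau>)"
      by (rule continuous_on_compose[OF \<tau>c]) (rule continuous_on_subset[OF kc], use \<tau> in auto)
    moreover have "bounded (range (g v))"
      by (rule bounded_subset[OF compact_imp_bounded[OF compact_continuous_image[OF kc compact_Icc]]])
         (use \<tau> in \<open>auto simp: g_def\<close>)
    ultimately show ?thesis
      by (simp add: bcontfun_def g_def[abs_def] o_def)
  qed
  define T where "T v = Bcontfun (g v)" for v
  have T: "apply_bcontfun (T v) t = g v t" for v t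
    by (simp add: T_def Bcontfun_inverse gcont)
  have contr: "dist (T x) (T y) \<le> 1/2 * dist x y" for x y
  proof (rule dist_bound)
    fix t0
    define t where "t = \<tau> t0"
    have t: "t \<in> {l..u}" using \<tau> t_def by auto
    have sub: "{l..t} \<subseteq> {l..u}" using t by auto
    have int: "(\<lambda>s. f s (w s * apply_bcontfun v s)) integrable_on {l..t}" for v
      using integrable_continuous_real[OF continuous_on_subset[OF fwcont sub]] .
    \<comment> \<open>Since \<open>w' = 2 * L * w\<close>, integrating \<open>L * w\<close> yields
      half of \<open>w\<close>: this is the contraction constant \<open>1/2\<close>.\<close>
    have wint: "((\<lambda>s. L * dist x y * w s) has_integral dist x y / 2 * w t - dist x y / 2 * w l) {l..t}"
      using t by (intro fundamental_theorem_of_calculus)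
        (auto simp: w_def has_real_derivative_iff_has_vector_derivative[symmetric]
              intro!: derivative_eq_intros)
    have "\<bar>integral {l..t} (\<lambda>s. f s (w s * apply_bcontfun x s)) - integral {l..t} (\<lambda>s. f s (w s * apply_bcontfun y s))\<bar>
       = norm (integral {l..t} (\<lambda>s. f s (w s * apply_bcontfun x s) - f s (w s * apply_bcontfun y s)))"
      by (simp add: integral_diff int)
    also have "\<dots> \<le> integral {l..t} (\<lambda>s. L * dist x y * w s)"
    proof (rule integral_norm_bound_integral)
      show "norm (f s (w s * apply_bcontfun x s) - f s (w s * apply_bcontfun y s)) \<le> L * dist x y * w s"
        if "s \<in> {l..t}" for s
      proof -
        have "norm (f s (w s * apply_bcontfun x s) - f s (w s * apply_bcontfun y s))
            \<le> L * \<bar>w s * apply_bcontfun x s - w s * apply_bcontfun y s\<bar>"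
          using lip that sub by auto
        also have "\<dots> = L * (w s * dist (apply_bcontfun x s) (apply_bcontfun y s))"
          using wpos[of s] by (simp add: dist_real_def abs_mult right_diff_distrib[symmetric])
        also have "\<dots> \<le> L * (w s * dist x y)"
          using wpos[of s] \<open>L > 0\<close> dist_bounded[of x s y] by (intro mult_left_mono) auto
        finally show ?thesis by (simp add: mult_ac)
      qed
    qed (use int wint in \<open>auto intro: integrable_diff\<close>)
    also have "\<dots> = dist x y / 2 * w t - dist x y / 2 * w l"
      using wint by (rule integral_unique)
    also have "\<dots> \<le> dist x y / 2 * w t"
      using wpos[of l] by simp
    finally have "\<bar>J (\<lambda>s. w s * apply_bcontfun x s) t - J (\<lambda>s. w s * apply_bcontfun y s) t\<bar> \<le> dist x y / 2 * w t"
      by (simp add: J_def)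
    then show "dist (apply_bcontfun (T x) t0) (apply_bcontfun (T y) t0) \<le> 1/2 * dist x y"
      using wpos[of t] by (simp add: T g_def t_def[symmetric] dist_real_def diff_divide_distrib[symmetric] field_simps)
  qed
  have "\<exists>!x. T x = x"
    by (rule banach_fix_type[where c = "1/2"]) (use contr in auto)
  then obtain v where v: "T v = v" by auto
  define y where "y t = w t * apply_bcontfun v t" for t
  have ycont: "continuous_on {l..u} y"
    unfolding y_def by (intro continuous_intros wcont continuous_on_apply_bcontfun)
  have yJ: "y t = J y t" if "t \<in> {l..u}" for t
    using arg_cong[OF v, of "\<lambda>v. apply_bcontfun v t"] that wpos[of t]
    by (simp add: T g_def y_def[abs_def] field_simps)
  show ?thesis
  proof
    show "y l = y0"
      using yJ[of l] \<open>l \<le> u\<close> by (simp add: J_def)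
    show "(y has_real_derivative f t (y t)) (at t within {l..u})" if "t \<in> {l..u}" for t
      using has_field_derivative_transform_within[OF Jder[OF ycont that] zero_less_one that] yJ
      by metis
  qed
qed

text \<open>A Gronwall estimate. It is stated for the square of the difference because the square,
  unlike the absolute value, is differentiable everywhere.\<close>

lemma solution_difference_bound:
  fixes x y :: "real \<Rightarrow> real"
  assumes "l \<le> u" "L > 0" "x l = y l"
    and x: "\<And>t. t \<in> {l..u} \<Longrightarrow> (x has_real_derivative f t (x t)) (at t within {l..u})"
    and y: "\<And>t. t \<in> {l..u} \<Longrightarrow> (y has_real_derivative g t (y t)) (at t within {l..u})"
    and lip: "\<And>t a b. t \<in> {l..u} \<Longrightarrow> \<bar>f t a - f t b\<bar> \<le> L * \<bar>a - b\<bar>"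
    and close: "\<And>t a. t \<in> {l..u} \<Longrightarrow> \<bar>f t a - g t a\<bar> \<le> \<delta>"
  shows "(x u - y u)\<^sup>2 \<le> \<delta>\<^sup>2 * ((u - l) * exp ((2 * L + 1) * (u - l)))"
proof -
  \<comment> \<open>\<open>2 * L\<close> absorbs the Lipschitz term, and the extra \<open>1\<close>
    absorbs the square of \<open>e t\<close> in \<open>2 * \<bar>e t\<bar> * \<delta> \<le> (e
    t)\<^sup>2 + \<delta>\<^sup>2\<close>.\<close>
  define K where "K = 2 * L + 1"
  define e where "e t = x t - y t" for t
  \<comment> \<open>\<open>\<phi>\<close> vanishes at \<open>l\<close>, so its monotonicity is the
    desired bound up to the exponential factor.\<close>
  define \<phi> where "\<phi> t = \<delta>\<^sup>2 * (t - l) - (e t)\<^sup>2 * exp (- K * (t - l))" for t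
  define \<phi>' where "\<phi>' t = \<delta>\<^sup>2 - (2 * e t * (f t (x t) - g t (y t)) - K * (e t)\<^sup>2) * exp (- K * (t - l))" for t
  have "\<phi> l \<le> \<phi> u"
  proof (rule nondecreasing_within[where f = \<phi> and f' = \<phi>' and l = l and u = u])
    show "(\<phi> has_real_derivative \<phi>' t) (at t within {l..u})" if "t \<in> {l..u}" for t
      unfolding \<phi>_def \<phi>'_def e_def using x[OF that] y[OF that]
      by (auto intro!: derivative_eq_intros simp: algebra_simps power2_eq_square)
    show "\<phi>' t \<ge> 0" if "l < t" "t < u" for t
    proof -
      have t: "t \<in> {l..u}" using that by auto
      define r where "r = f t (x t) - g t (y t)"
      have "\<bar>r\<bar> \<le> L * \<bar>e t\<bar> + \<delta>"
        using lip[OF t, of "x t" "y t"] close[OF t, of "y t"] by (auto simp: r_def e_def)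
      then have "\<bar>e t\<bar> * \<bar>r\<bar> \<le> \<bar>e t\<bar> * (L * \<bar>e t\<bar> + \<delta>)"
        by (rule mult_left_mono) simp
      then have "2 * (e t * r) \<le> 2 * L * (e t)\<^sup>2 + 2 * \<bar>e t\<bar> * \<delta>"
        using abs_ge_self[of "e t * r"] by (simp add: abs_mult algebra_simps power2_eq_square)
      moreover have "2 * \<bar>e t\<bar> * \<delta> \<le> (e t)\<^sup>2 + \<delta>\<^sup>2"
        using zero_le_power2[of "\<bar>e t\<bar> - \<delta>"] by (simp add: power2_diff)
      ultimately have *: "2 * e t * r - K * (e t)\<^sup>2 \<le> \<delta>\<^sup>2"
        by (simp add: K_def algebra_simps)
      have "exp (- K * (t - l)) \<le> 1"
        using that \<open>L > 0\<close> by (simp add: K_def mult_nonpos_nonneg)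
      then have "\<delta>\<^sup>2 * exp (- K * (t - l)) \<le> \<delta>\<^sup>2"
        by (intro mult_left_le) auto
      moreover have "(2 * e t * r - K * (e t)\<^sup>2) * exp (- K * (t - l)) \<le> \<delta>\<^sup>2 * exp (- K * (t - l))"
        using * by (intro mult_right_mono) auto
      ultimately have "(2 * e t * r - K * (e t)\<^sup>2) * exp (- K * (t - l)) \<le> \<delta>\<^sup>2"
        by linarith
      then show ?thesis by (simp add: \<phi>'_def r_def)
    qed
  qed (use assms in auto)
  then have "(e u)\<^sup>2 * exp (- K * (u - l)) \<le> \<delta>\<^sup>2 * (u - l)"
    using assms by (simp add: \<phi>_def e_def)
  then have "(e u)\<^sup>2 * exp (- K * (u - l)) * exp (K * (u - l)) \<le> \<delta>\<^sup>2 * (u - l) * exp (K * (u - l))"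
    by (rule mult_right_mono) simp
  moreover have "exp (- K * (u - l)) * exp (K * (u - l)) = 1"
    by (simp add: exp_add[symmetric])
  ultimately show ?thesis
    by (simp only: e_def[symmetric] K_def[symmetric] mult.assoc mult_1_right)
qed

section \<open>Smoothness of solutions\<close>

text \<open>Dependent choice inside the family \<open>F\<close> picks the successive derivatives,
  with the one at index 0 pinned to \<open>f\<close>.\<close>

lemma smooth_on_setI:
  assumes "f \<in> F"
    and "\<And>g. g \<in> F \<Longrightarrow> \<exists>g'\<in>F. \<forall>x\<in>S. (g has_real_derivative g' x) (at x within S)"
  shows "smooth_on_set f S"
proof -
  let ?Q = "\<lambda>g g'. \<forall>x\<in>S. (g has_real_derivative g' x) (at x within S)"
  obtain D where "\<And>n. (D n \<in> F \<and> (n = 0 \<longrightarrow> D n = f)) \<and> ?Q (D n) (D (Suc n))"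
    using dependent_nat_choice[of "\<lambda>n g. g \<in> F \<and> (n = 0 \<longrightarrow> g = f)" "\<lambda>_. ?Q"] assms
    by (metis nat.distinct(1))
  then show ?thesis
    unfolding smooth_on_set_def by (intro exI[of _ D]) simp
qed

text \<open>
  Along a solution of $v' = c\sqrt v + q$ these functions are closed under differentiation, which
  makes all of them smooth.
\<close>

inductive_set sqrt_algebra :: "(real \<Rightarrow> real) \<Rightarrow> (real \<Rightarrow> real) set" for v where
  poly: "poly q \<in> sqrt_algebra v"
| root: "(\<lambda>t. sqrt (v t)) \<in> sqrt_algebra v"
| inverse_root: "(\<lambda>t. inverse (sqrt (v t))) \<in> sqrt_algebra v"
| add: "f \<in> sqrt_algebra v \<Longrightarrow> g \<in> sqrt_algebra v \<Longrightarrow> (\<lambda>t. f t + g t) \<in> sqrt_algebra v"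
| mult: "f \<in> sqrt_algebra v \<Longrightarrow> g \<in> sqrt_algebra v \<Longrightarrow> (\<lambda>t. f t * g t) \<in> sqrt_algebra v"

lemma sqrt_algebra_const: "(\<lambda>_. c) \<in> sqrt_algebra v"
proof -
  have "poly [:c:] = (\<lambda>_. c)" by auto
  then show ?thesis by (metis sqrt_algebra.poly)
qed

lemma smooth_on_set_sqrt_ode:
  assumes pos: "\<And>t. t \<in> S \<Longrightarrow> v t > 0"
    and der: "\<And>t. t \<in> S \<Longrightarrow> (v has_real_derivative c * sqrt (v t) + poly q t) (at t within S)"
  shows "smooth_on_set v S"
proof -
  let ?s = "\<lambda>t. sqrt (v t)" and ?i = "\<lambda>t. inverse (sqrt (v t))"
  \<comment> \<open>This is \<open>v' / (2 * sqrt v)\<close> with the equation for \<open>v'\<close>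
    inserted.\<close>
  define s' where "s' t = c / 2 + 1 / 2 * (poly q t * ?i t)" for t
  have s'_mem: "s' \<in> sqrt_algebra v"
    unfolding s'_def[abs_def] by (intro sqrt_algebra.intros sqrt_algebra_const)
  have s': "(?s has_real_derivative s' t) (at t within S)" if "t \<in> S" for t
    using pos[OF that]
    by (intro DERIV_cong[OF DERIV_chain2[OF DERIV_real_sqrt der[OF that]]])
      (auto simp: s'_def field_simps)
  have "\<exists>g'\<in>sqrt_algebra v. \<forall>t\<in>S. (g has_real_derivative g' t) (at t within S)"
    if "g \<in> sqrt_algebra v" for g
    using that
  proof induction
    case (poly q)
    show ?case
      by (rule bexI[OF _ sqrt_algebra.poly[of "pderiv q"]])
        (auto intro: has_field_derivative_at_within poly_DERIV)
  next
    case root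
    show ?case
      using s' s'_mem by blast
  next
    case inverse_root
    have "(?i has_real_derivative - 1 * (s' t * (?i t * ?i t))) (at t within S)" if "t \<in> S" for t
      using pos[OF that]
      by (intro DERIV_cong[OF DERIV_inverse'[OF s'[OF that]]]) auto
    moreover have "(\<lambda>t. - 1 * (s' t * (?i t * ?i t))) \<in> sqrt_algebra v"
      by (intro sqrt_algebra.intros sqrt_algebra_const s'_mem)
    ultimately show ?case by (intro bexI) auto
  next
    case (add f g)
    then obtain f' g' where "f' \<in> sqrt_algebra v" "g' \<in> sqrt_algebra v"
      "\<forall>t\<in>S. (f has_real_derivative f' t) (at t within S)"
      "\<forall>t\<in>S. (g has_real_derivative g' t) (at t within S)"
      by blast
    then show ?case
      by (intro bexI[of _ "\<lambda>t. f' t + g' t"]) (auto intro: DERIV_add sqrt_algebra.add)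
  next
    case (mult f g)
    then obtain f' g' where "f' \<in> sqrt_algebra v" "g' \<in> sqrt_algebra v"
      "\<forall>t\<in>S. (f has_real_derivative f' t) (at t within S)"
      "\<forall>t\<in>S. (g has_real_derivative g' t) (at t within S)"
      by blast
    with mult.hyps show ?case
      by (intro bexI[of _ "\<lambda>t. f' t * g t + g' t * f t"])
        (auto intro: DERIV_mult sqrt_algebra.intros)
  qed
  \<comment> \<open>\<open>v\<close> is not a generator, but the product of the two roots agrees
    with it on \<open>S\<close>, and smoothness on \<open>S\<close> depends only on values
    there.\<close>
  then have "smooth_on_set (\<lambda>t. ?s t * ?s t) S"
    by (intro smooth_on_setI[of _ "sqrt_algebra v"] sqrt_algebra.intros) auto
  moreover have "?s t * ?s t = v t" if "t \<in> S" for t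
    using pos[OF that] by simp
  ultimately show ?thesis
    unfolding smooth_on_set_def by auto
qed

section \<open>The coefficient \<open>p\<close>, its zero and its antiderivative\<close>

locale bvp_parameters =
  fixes m b0 :: real
  assumes m_pos: "m > 0" and b0_pos: "b0 > 0"
begin

abbreviation p :: "real \<Rightarrow> real \<Rightarrow> real" where
  "p \<equiv> p_fun m b0"

lemma denom_pos: "m * (m + 2) > 0"
  using m_pos by simp

lemma denom_nonzero: "m * (m + 2) \<noteq> 0"
  using denom_pos by linarith

text \<open>Expanding around \<open>t = 1\<close> displays the value there and makes the dependence
  on \<open>\<beta>\<close> monotone for \<open>t > 1\<close>.\<close>

lemma p_eq: "p \<beta> t = 2 * b0 - 2 * (b0 + \<beta>) * (t\<^sup>2 - 1) / (m * (m + 2))"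
  using m_pos
  by (simp add: p_fun_def coeff_B_def coeff_C_def divide_simps) (simp add: algebra_simps power2_eq_square)

lemma p_diff: "p \<beta>1 t - p \<beta>2 t = 2 * (\<beta>2 - \<beta>1) * (t\<^sup>2 - 1) / (m * (m + 2))"
  by (simp add: p_eq diff_divide_distrib[symmetric] algebra_simps)

lemma p_at_1: "p \<beta> 1 = 2 * b0"
  by (simp add: p_eq)

lemma endpoint_square: "(m + 1)\<^sup>2 - 1 = m * (m + 2)"
  by (simp add: power2_eq_square algebra_simps)

lemma p_at_end: "p \<beta> (m + 1) = - 2 * \<beta>"
  unfolding p_eq endpoint_square nonzero_mult_div_cancel_right[OF denom_nonzero] by simp

definition zero_of_p :: "real \<Rightarrow> real" where
  "zero_of_p \<beta> = sqrt (1 + m * (m + 2) * b0 / (b0 + \<beta>))"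

text \<open>The antiderivative of \<open>p \<beta> t * t\<close> that vanishes at 1, written in
  terms of \<open>t\<^sup>2 - 1\<close>.\<close>

definition P :: "real \<Rightarrow> real \<Rightarrow> real" where
  "P \<beta> t = b0 * (t\<^sup>2 - 1) - (b0 + \<beta>) * (t\<^sup>2 - 1)\<^sup>2 / (2 * (m * (m + 2)))"

lemma P_deriv: "(P \<beta> has_real_derivative p \<beta> t * t) (at t within S)"
  unfolding P_def p_eq using denom_pos
  by (auto intro!: derivative_eq_intros simp: divide_simps) (simp add: algebra_simps power2_eq_square)

lemma P_at_1: "P \<beta> 1 = 0"
  by (simp add: P_def)

lemma P_at_end: "P \<beta> (m + 1) = (b0 - \<beta>) * (m * (m + 2)) / 2"
proof -
  define K where "K = m * (m + 2)"
  have "K \<noteq> 0"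
    using denom_nonzero by (simp add: K_def)
  then show ?thesis
    unfolding P_def endpoint_square K_def[symmetric]
    by (simp add: field_simps power2_eq_square)
qed

context
  fixes \<beta> :: real
  assumes \<beta>_pos: "\<beta> > 0"
begin

lemma zero_square: "(zero_of_p \<beta>)\<^sup>2 - 1 = m * (m + 2) * b0 / (b0 + \<beta>)"
  using m_pos b0_pos \<beta>_pos by (simp add: zero_of_p_def)

lemma zero_gt_1: "zero_of_p \<beta> > 1"
  using m_pos b0_pos \<beta>_pos by (simp add: zero_of_p_def)

lemma zero_less_end: "zero_of_p \<beta> < m + 1"
proof -
  have "m * (m + 2) * b0 / (b0 + \<beta>) < m * (m + 2)"
    using mult_strict_left_mono[OF _ denom_pos, of b0 "b0 + \<beta>"] b0_pos \<beta>_pos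
    by (simp add: pos_divide_less_eq)
  then have "(zero_of_p \<beta>)\<^sup>2 < (m + 1)\<^sup>2"
    using zero_square endpoint_square by linarith
  then show ?thesis
    using m_pos by (simp add: power2_less_imp_less)
qed

lemma p_factor: "p \<beta> t = 2 * (b0 + \<beta>) / (m * (m + 2)) * ((zero_of_p \<beta>)\<^sup>2 - t\<^sup>2)"
proof -
  have "(zero_of_p \<beta>)\<^sup>2 - t\<^sup>2 = m * (m + 2) * b0 / (b0 + \<beta>) - (t\<^sup>2 - 1)"
    using zero_square by simp
  then show ?thesis
    using denom_pos b0_pos \<beta>_pos by (simp add: p_eq field_simps)
qed

lemma p_pos: "p \<beta> t > 0" if "0 \<le> t" "t < zero_of_p \<beta>"
  using power_strict_mono[of t "zero_of_p \<beta>" 2] that denom_pos b0_pos \<beta>_pos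
  by (simp add: p_factor)

lemma p_neg: "p \<beta> t < 0" if "zero_of_p \<beta> < t"
  using power_strict_mono[of "zero_of_p \<beta>" t 2] that denom_pos b0_pos \<beta>_pos zero_gt_1
  unfolding p_factor by (intro mult_pos_neg) auto

lemma P_at_zero: "P \<beta> (zero_of_p \<beta>) = m * (m + 2) * b0\<^sup>2 / (2 * (b0 + \<beta>))"
proof -
  define K s where "K = m * (m + 2)" and "s = b0 + \<beta>"
  have "K \<noteq> 0" "s \<noteq> 0"
    using denom_pos b0_pos \<beta>_pos by (auto simp: K_def s_def)
  then show ?thesis
    unfolding P_def zero_square K_def[symmetric] s_def[symmetric]
    by (simp add: field_simps power2_eq_square)
qed

section \<open>Sign analysis of the linear equation \<open>d' = a d + p t\<close>\<close>

context
  fixes a d :: "real \<Rightarrow> real"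
  assumes a_cont: "continuous_on {1..m + 1} a"
    and a_pos: "\<And>t. t \<in> {1..m + 1} \<Longrightarrow> a t > 0"
    and d_1: "d 1 = 0"
    and d_deriv: "\<And>t. t \<in> {1..m + 1} \<Longrightarrow>
      (d has_real_derivative a t * d t + p \<beta> t * t) (at t within {1..m + 1})"
begin

lemma linear_positive:
  assumes "d (m + 1) = 0" "t \<in> {1<..<m + 1}"
  shows "d t > 0"
proof -
  obtain E where E1: "E 1 = 1" and E: "\<And>t. 0 < E t"
    and E': "\<And>t. t \<in> {1..m + 1} \<Longrightarrow> (E has_real_derivative - a t * E t) (at t within {1..m + 1})"
    using integrating_factor[OF a_cont] by blast
  note D = integrating_factor_deriv[OF E' d_deriv]
  have "0 < d t * E t"
  \<comment> \<open>Left of the zero of \<open>p\<close> the product grows from its value at 1;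
    right of it, it falls towards its value at \<open>m + 1\<close>.\<close>
  proof (cases "t \<le> zero_of_p \<beta>")
    case True
    have "d 1 * E 1 < d t * E t"
      by (rule increasing_within[OF _ _ D]) (use assms True p_pos E in auto)
    then show ?thesis by (simp add: d_1)
  next
    case False
    have "d (m + 1) * E (m + 1) < d t * E t"
      by (rule decreasing_within[OF _ _ D])
        (use assms False p_neg E zero_gt_1 in \<open>auto intro!: mult_neg_pos\<close>)
    then show ?thesis by (simp add: assms)
  qed
  then show ?thesis
    using E[of t] by (simp add: zero_less_mult_iff)
qed

text \<open>\<open>p\<close> and \<open>E t - E z\<close> change sign together at \<open>z\<close>,
  so replacing \<open>E\<close> by the constant \<open>E z\<close> underestimates the integral of
  \<open>p t E\<close>. The sign of \<open>P \<beta> (m + 1)\<close> is that of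
  \<open>b0 - \<beta>\<close>. The inequality at \<open>m + 1\<close>, instead of equality, also
  serves the shooting argument.\<close>

lemma linear_beta_greater:
  assumes "d (m + 1) \<le> 0"
  shows "\<beta> > b0"
proof -
  obtain E where E1: "E 1 = 1" and E: "\<And>t. 0 < E t"
    and E': "\<And>t. t \<in> {1..m + 1} \<Longrightarrow> (E has_real_derivative - a t * E t) (at t within {1..m + 1})"
    using integrating_factor[OF a_cont] by blast
  note D = integrating_factor_deriv[OF E' d_deriv]
  define z where "z = zero_of_p \<beta>"
  have z: "1 < z" "z < m + 1"
    using zero_gt_1 zero_less_end by (simp_all add: z_def)
  have E_dec: "E y < E x" if "1 \<le> x" "x < y" "y \<le> m + 1" for x y
    by (rule decreasing_within[OF _ _ E']) (use that a_pos E in \<open>auto intro!: mult_pos_pos\<close>)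
  define \<phi> where "\<phi> t = d t * E t - E z * P \<beta> t" for t
  have \<phi>': "(\<phi> has_real_derivative p \<beta> t * t * (E t - E z)) (at t within {1..m + 1})"
    if "t \<in> {1..m + 1}" for t
    unfolding \<phi>_def
    by (rule DERIV_cong[OF DERIV_diff[OF D[OF that that] DERIV_cmult[OF P_deriv]]])
      (simp add: algebra_simps)
  have "\<phi> 1 < \<phi> z"
    by (rule increasing_within[OF _ _ \<phi>'])
      (use z p_pos E_dec in \<open>auto simp: z_def intro!: mult_pos_pos\<close>)
  also have "\<phi> z < \<phi> (m + 1)"
    by (rule increasing_within[OF _ _ \<phi>'])
      (use z p_neg E_dec in \<open>auto simp: z_def intro!: mult_neg_neg mult_neg_pos\<close>)
  finally have "E z * P \<beta> (m + 1) < d (m + 1) * E (m + 1)"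
    by (simp add: \<phi>_def d_1 P_at_1)
  also have "\<dots> \<le> 0"
    using assms E[of "m + 1"] by (simp add: mult_nonpos_nonneg)
  finally have "P \<beta> (m + 1) < 0"
    using E[of z] by (simp add: mult_less_0_iff)
  then show ?thesis
    using m_pos by (simp add: P_at_end mult_less_0_iff)
qed

text \<open>With \<open>1 / (m + 1) \<le> E t \<le> 1\<close>, the integral of \<open>p t E\<close>
  is overestimated by taking \<open>E\<close> as 1 where \<open>p\<close> is positive and as
  \<open>1 / (m + 1)\<close> where \<open>p\<close> is negative.\<close>

lemma linear_end_negative:
  assumes a_le: "\<And>t. t \<in> {1..m + 1} \<Longrightarrow> a t \<le> 1 / t" and \<beta>: "\<beta> = b0 * (m + 1)"
  shows "d (m + 1) < 0"
proof -
  obtain E where E1: "E 1 = 1" and E: "\<And>t. 0 < E t"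
    and E': "\<And>t. t \<in> {1..m + 1} \<Longrightarrow> (E has_real_derivative - a t * E t) (at t within {1..m + 1})"
    using integrating_factor[OF a_cont] by blast
  note D = integrating_factor_deriv[OF E' d_deriv]
  define z where "z = zero_of_p \<beta>"
  have z: "1 < z" "z < m + 1"
    using zero_gt_1 zero_less_end by (simp_all add: z_def)
  have E_le: "E t \<le> 1" if "1 < t" "t \<le> m + 1" for t
    using decreasing_within[OF _ _ E', of 1 t] that a_pos E E1 by (force intro!: mult_pos_pos)
  have E_ge: "1 / (m + 1) \<le> E t" if "1 < t" "t \<le> m + 1" for t
  proof -
    \<comment> \<open>The bound \<open>a t \<le> 1 / t\<close> makes \<open>t * E t\<close>
      nondecreasing.\<close>
    have "1 * E 1 \<le> t * E t"
    proof (rule nondecreasing_within[where f = "\<lambda>t. t * E t" and f' = "\<lambda>t. (1 - t * a t) * E t" and l = 1 and u = "m + 1"])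
      show "((\<lambda>t. t * E t) has_real_derivative (1 - s * a s) * E s) (at s within {1..m + 1})"
        if "s \<in> {1..m + 1}" for s
        by (rule DERIV_cong[OF DERIV_mult[OF DERIV_ident E'[OF that]]]) (simp add: algebra_simps)
      show "0 \<le> (1 - s * a s) * E s" if "1 < s" "s < t" for s
        using a_le[of s] E[of s] that \<open>t \<le> m + 1\<close> by (auto simp: field_simps)
    qed (use that in auto)
    also have "\<dots> \<le> (m + 1) * E t"
      using that E[of t] by simp
    finally show ?thesis
      using E1 m_pos by (simp add: field_simps)
  qed
  \<comment> \<open>Used with \<open>c = 1\<close> on \<open>{1..z}\<close> and with
    \<open>c = 1 / (m + 1)\<close> on \<open>{z..m + 1}\<close>; in both cases \<open>p\<close> and
    \<open>c - E t\<close> have matching signs.\<close>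
  define \<phi> where "\<phi> c t = c * P \<beta> t - d t * E t" for c t
  have \<phi>': "(\<phi> c has_real_derivative p \<beta> t * t * (c - E t)) (at t within {1..m + 1})"
    if "t \<in> {1..m + 1}" for c t
    unfolding \<phi>_def
    by (rule DERIV_cong[OF DERIV_diff[OF DERIV_cmult[OF P_deriv] D[OF that that]]])
      (simp add: algebra_simps)
  have "\<phi> 1 1 \<le> \<phi> 1 z"
    by (rule nondecreasing_within[OF _ _ \<phi>'])
      (use z p_pos E_le in \<open>auto simp: z_def intro!: mult_nonneg_nonneg less_imp_le[OF p_pos]\<close>)
  then have "d z * E z \<le> P \<beta> z"
    by (simp add: \<phi>_def d_1 P_at_1)
  moreover have "\<phi> (1 / (m + 1)) z \<le> \<phi> (1 / (m + 1)) (m + 1)"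
    by (rule nondecreasing_within[OF _ _ \<phi>'])
      (use z E_ge in \<open>auto simp: z_def intro!: mult_nonpos_nonpos mult_nonpos_nonneg less_imp_le[OF p_neg]\<close>)
  ultimately have "d (m + 1) * E (m + 1) \<le> P \<beta> z + (P \<beta> (m + 1) - P \<beta> z) / (m + 1)"
    by (simp add: \<phi>_def diff_divide_distrib)
  \<comment> \<open>The bound is a positive multiple of
    \<open>b0\<^sup>2 - \<beta>\<^sup>2 / (m + 1)\<close>, which equals
    \<open>- m * b0\<^sup>2\<close> for \<open>\<beta> = b0 * (m + 1)\<close>.\<close>
  also have "\<dots> < 0"
  proof -
    have "P \<beta> (m + 1) - P \<beta> z = - m * (m + 2) * b0\<^sup>2 * (m + 1)\<^sup>2 / (2 * (b0 + \<beta>))"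
      unfolding P_at_end P_at_zero z_def using b0_pos \<beta>_pos
      by (simp add: field_simps) (simp add: \<beta> algebra_simps power2_eq_square)
    then have "P \<beta> z + (P \<beta> (m + 1) - P \<beta> z) / (m + 1) = - (m * (m + 2) * b0\<^sup>2 / (2 * (b0 + \<beta>)) * m)"
      unfolding P_at_zero[folded z_def] using b0_pos \<beta>_pos m_pos
      by (simp add: divide_simps) (simp add: algebra_simps power2_eq_square)
    also have "\<dots> < 0"
      using m_pos b0_pos \<beta>_pos by simp
    finally show ?thesis .
  qed
  finally show ?thesis
    using E[of "m + 1"] by (simp add: mult_less_0_iff)
qed

end

end

section \<open>A priori bounds and uniqueness\<close>

lemma solution_continuous: "smooth_bvp_solution m b0 \<beta> w \<Longrightarrow> continuous_on {1..m + 1} w"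
  unfolding smooth_bvp_solution_def by (intro DERIV_continuous_on) blast

text \<open>Factoring \<open>w t - 2 * t\<^sup>2\<close> as a difference of squares puts every
  solution into the linear form treated above.\<close>

lemma solution_linear:
  assumes "smooth_bvp_solution m b0 \<beta> w"
  defines "a \<equiv> \<lambda>t. 2 * sqrt 2 / (sqrt (w t) + sqrt 2 * t)" and "d \<equiv> \<lambda>t. w t - 2 * t\<^sup>2"
  shows "continuous_on {1..m + 1} a" "\<And>t. t \<in> {1..m + 1} \<Longrightarrow> a t > 0" "d 1 = 0" "d (m + 1) = 0"
    "\<And>t. t \<in> {1..m + 1} \<Longrightarrow> (d has_real_derivative a t * d t + p \<beta> t * t) (at t within {1..m + 1})"
proof -
  note w = assms(1)[unfolded smooth_bvp_solution_def]
  have den: "sqrt (w t) + sqrt 2 * t > 0" if "t \<in> {1..m + 1}" for t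
    using w that by (intro add_nonneg_pos) auto
  show "continuous_on {1..m + 1} a"
    unfolding a_def using den solution_continuous[OF assms(1)]
    by (intro continuous_intros) (auto simp: less_imp_neq[symmetric])
  show "a t > 0" if "t \<in> {1..m + 1}" for t
    using den[OF that] by (simp add: a_def)
  show "d 1 = 0" "d (m + 1) = 0"
    using w by (auto simp: d_def)
  show "(d has_real_derivative a t * d t + p \<beta> t * t) (at t within {1..m + 1})"
    if t: "t \<in> {1..m + 1}" for t
  proof -
    have "d t = (sqrt (w t) - sqrt 2 * t) * (sqrt (w t) + sqrt 2 * t)"
      using w t by (simp add: d_def algebra_simps power2_eq_square)
    then have "a t * d t = 2 * sqrt 2 * (sqrt (w t) - sqrt 2 * t)"
      using den[OF t] by (simp add: a_def)
    then have "a t * d t + p \<beta> t * t = 2 * sqrt 2 * sqrt (w t) + p \<beta> t * t - 4 * t"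
      by (simp add: algebra_simps)
    moreover have "(d has_real_derivative 2 * sqrt 2 * sqrt (w t) + p \<beta> t * t - 4 * t) (at t within {1..m + 1})"
      unfolding d_def using w t by (auto intro!: derivative_eq_intros)
    ultimately show ?thesis by metis
  qed
qed

text \<open>Strict positivity on the closed interval, with the ends covered by the boundary values,
  keeps the denominators nonzero when two solutions are compared.\<close>

lemma solution_bound:
  assumes "\<beta> > 0" "smooth_bvp_solution m b0 \<beta> w"
  shows "b0 < \<beta>" "\<And>t. t \<in> {1<..<m + 1} \<Longrightarrow> 2 * t\<^sup>2 < w t" "\<And>t. t \<in> {1..m + 1} \<Longrightarrow> 0 < w t"
proof -
  note * = solution_linear[OF assms(2)]
  show "b0 < \<beta>"
    using linear_beta_greater[OF assms(1) *(1,2,3,5)] *(4) by simp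
  show inner: "2 * t\<^sup>2 < w t" if "t \<in> {1<..<m + 1}" for t
    using linear_positive[OF assms(1) *(1,2,3,5,4) that] by simp
  show "0 < w t" if "t \<in> {1..m + 1}" for t
  proof (cases "t \<in> {1<..<m + 1}")
    case True
    then show ?thesis
      using inner[of t] zero_le_power2[of t] by linarith
  next
    case False
    then have "t = 1 \<or> t = m + 1" using that by auto
    then show ?thesis
      using assms(2) m_pos by (auto simp: smooth_bvp_solution_def)
  qed
qed

text \<open>The difference solves a linear equation whose forcing has the sign of
  \<open>\<beta>2 - \<beta>1\<close> for \<open>t > 1\<close>. Strict forcing contradicts the common
  boundary values; for equal parameters, exchanging the two solutions gives equality.\<close>

lemma solution_compare:
  assumes "\<beta>1 > 0" "\<beta>1 \<le> \<beta>2"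
    and sol: "smooth_bvp_solution m b0 \<beta>1 w1" "smooth_bvp_solution m b0 \<beta>2 w2"
  shows "\<beta>1 = \<beta>2" "\<And>t. t \<in> {1..m + 1} \<Longrightarrow> w2 t \<le> w1 t"
proof -
  note w1 = sol(1)[unfolded smooth_bvp_solution_def] and w2 = sol(2)[unfolded smooth_bvp_solution_def]
  have "\<beta>2 > 0" using assms by simp
  note pos = solution_bound(3)[OF \<open>\<beta>1 > 0\<close> sol(1)] solution_bound(3)[OF \<open>\<beta>2 > 0\<close> sol(2)]
  define a where "a t = 2 * sqrt 2 / (sqrt (w1 t) + sqrt (w2 t))" for t
  define e where "e t = w1 t - w2 t" for t
  define g where "g t = (p \<beta>1 t - p \<beta>2 t) * t" for t
  have den: "sqrt (w1 t) + sqrt (w2 t) > 0" if "t \<in> {1..m + 1}" for t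
    using pos that by (simp add: add_pos_pos)
  have "continuous_on {1..m + 1} w1" "continuous_on {1..m + 1} w2"
    using sol by (auto intro: solution_continuous)
  then have "continuous_on {1..m + 1} a"
    unfolding a_def using den by (intro continuous_intros) (auto simp: less_imp_neq[symmetric])
  then obtain E where E1: "E 1 = 1" and E: "\<And>t. 0 < E t"
    and E': "\<And>t. t \<in> {1..m + 1} \<Longrightarrow> (E has_real_derivative - a t * E t) (at t within {1..m + 1})"
    using integrating_factor by blast
  have e': "(e has_real_derivative a t * e t + g t) (at t within {1..m + 1})" if t: "t \<in> {1..m + 1}" for t
  proof -
    have "e t = (sqrt (w1 t) - sqrt (w2 t)) * (sqrt (w1 t) + sqrt (w2 t))"
      using pos t by (simp add: e_def algebra_simps less_imp_le)
    then have "a t * e t = 2 * sqrt 2 * (sqrt (w1 t) - sqrt (w2 t))"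
      using den[OF t] by (simp add: a_def)
    then have *: "a t * e t + g t = (2 * sqrt 2 * sqrt (w1 t) + p \<beta>1 t * t) - (2 * sqrt 2 * sqrt (w2 t) + p \<beta>2 t * t)"
      by (simp add: g_def algebra_simps)
    show ?thesis
      unfolding * unfolding e_def using w1 w2 t by (intro DERIV_diff) auto
  qed
  have e_ends: "e 1 = 0" "e (m + 1) = 0"
    using w1 w2 by (auto simp: e_def)
  show "w2 t \<le> w1 t" if "t \<in> {1..m + 1}" for t
  proof -
    have "e 1 * E 1 \<le> e t * E t"
    proof (rule nondecreasing_within[OF _ _ integrating_factor_deriv[OF E' e']])
      show "0 \<le> g s * E s" if "1 < s" for s
        using that assms(2) m_pos E[of s] one_less_power[OF that, of 2]
        unfolding g_def p_diff by (intro mult_nonneg_nonneg divide_nonneg_nonneg) simp_all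
    qed (use that in auto)
    then have "0 \<le> e t"
      using E[of t] by (simp add: e_ends zero_le_mult_iff)
    then show ?thesis
      by (simp add: e_def)
  qed
  show "\<beta>1 = \<beta>2"
  proof (rule ccontr)
    assume "\<beta>1 \<noteq> \<beta>2"
    have "e 1 * E 1 < e (m + 1) * E (m + 1)"
    proof (rule increasing_within[OF _ _ integrating_factor_deriv[OF E' e']])
      show "0 < g s * E s" if "1 < s" for s
        using that assms(2) \<open>\<beta>1 \<noteq> \<beta>2\<close> m_pos E[of s] one_less_power[OF that, of 2]
        unfolding g_def p_diff by (intro mult_pos_pos divide_pos_pos) simp_all
    qed (use m_pos in auto)
    then show False
      by (simp add: e_ends)
  qed
qed

end

section \<open>A globally Lipschitz extension of the equation\<close>

text \<open>
  For $y < 0$ the factor is frozen at its value for $y = 0$. Unlike the square root in the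
  original equation, the resulting term $y$ times this slope is globally Lipschitz, and it
  agrees with the original one as long as $v = 2t^2 + y \ge 2t^2$.
\<close>

definition extended_slope :: "real \<Rightarrow> real \<Rightarrow> real" where
  "extended_slope t y = 2 * sqrt 2 / (sqrt (2 * t\<^sup>2 + max y 0) + sqrt 2 * t)"

lemma extended_slope_denom: "t > 0 \<Longrightarrow> sqrt (2 * t\<^sup>2 + max y 0) + sqrt 2 * t > 0"
  by (intro add_nonneg_pos) auto

lemma extended_slope_pos: "t > 0 \<Longrightarrow> extended_slope t y > 0"
  using extended_slope_denom by (simp add: extended_slope_def)

text \<open>The denominator is at least \<open>2 * sqrt 2 * t\<close>. This supplies the bound on
  \<open>a\<close> required by \<open>linear_end_negative\<close>.\<close>

lemma extended_slope_le:
  assumes "t > 0"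
  shows "extended_slope t y \<le> 1 / t"
proof -
  have "sqrt 2 * t = sqrt (2 * t\<^sup>2)"
    using assms by (simp add: real_sqrt_mult)
  also have "\<dots> \<le> sqrt (2 * t\<^sup>2 + max y 0)"
    by simp
  finally show ?thesis
    using assms extended_slope_denom[OF assms, of y] by (simp add: extended_slope_def field_simps)
qed

text \<open>Separates the positive part of \<open>y\<close>, which enters through the root, from the
  negative part, which enters linearly; one of the two summands always vanishes.\<close>

lemma extended_slope_mult:
  assumes "t > 0"
  shows "extended_slope t y * y = 2 * sqrt 2 * (sqrt (2 * t\<^sup>2 + max y 0) - sqrt 2 * t) + min y 0 / t"
proof (cases "y \<ge> 0")
  case True
  have "y = (sqrt (2 * t\<^sup>2 + max y 0) - sqrt 2 * t) * (sqrt (2 * t\<^sup>2 + max y 0) + sqrt 2 * t)"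
    using True by (simp add: algebra_simps power2_eq_square)
  then show ?thesis
    using True extended_slope_denom[OF assms, of y]
    by (simp add: extended_slope_def max_def nonzero_divide_eq_eq)
next
  case False
  then have "sqrt (2 * t\<^sup>2 + max y 0) = sqrt 2 * t"
    using assms by (simp add: real_sqrt_mult)
  then show ?thesis
    using assms False by (simp add: extended_slope_def)
qed

lemma extended_slope_lipschitz:
  assumes "t \<ge> 1"
  shows "\<bar>extended_slope t x * x - extended_slope t y * y\<bar> \<le> \<bar>x - y\<bar>"
proof -
  define A B where "A = sqrt (2 * t\<^sup>2 + max x 0)" and "B = sqrt (2 * t\<^sup>2 + max y 0)"
  have ge: "sqrt 2 \<le> A" "sqrt 2 \<le> B"
    using one_le_power[OF assms, of 2] by (auto simp: A_def B_def)
  have "2 * sqrt 2 * \<bar>A - B\<bar> \<le> (A + B) * \<bar>A - B\<bar>"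
    using ge by (intro mult_right_mono) auto
  also have "\<dots> = \<bar>(A + B) * (A - B)\<bar>"
    by (simp add: abs_mult A_def B_def)
  also have "(A + B) * (A - B) = max x 0 - max y 0"
    by (simp add: A_def B_def algebra_simps)
  finally have AB: "\<bar>2 * sqrt 2 * (A - B)\<bar> \<le> \<bar>max x 0 - max y 0\<bar>"
    by (simp add: abs_mult)
  have "\<bar>min x 0 - min y 0\<bar> / t \<le> \<bar>min x 0 - min y 0\<bar>"
    using assms by (simp add: divide_le_eq mult_le_cancel_left1)
  then have min: "\<bar>(min x 0 - min y 0) / t\<bar> \<le> \<bar>min x 0 - min y 0\<bar>"
    using assms by simp
  have "extended_slope t x * x - extended_slope t y * y
      = 2 * sqrt 2 * (A - B) + (min x 0 - min y 0) / t"
    using assms unfolding A_def B_def diff_divide_distrib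
    by (subst (1 2) extended_slope_mult) (auto simp: right_diff_distrib)
  \<comment> \<open>Positive and negative parts move in the same direction, so the two bounds add up
    to Lipschitz constant 1.\<close>
  moreover have "\<bar>max x 0 - max y 0\<bar> + \<bar>min x 0 - min y 0\<bar> = \<bar>x - y\<bar>"
    by (auto simp: max_def min_def)
  ultimately show ?thesis
    using AB min by linarith
qed

section \<open>Shooting and existence\<close>

context bvp_parameters
begin

definition rhs :: "real \<Rightarrow> real \<Rightarrow> real \<Rightarrow> real" where
  "rhs \<beta> t y = extended_slope t y * y + p \<beta> t * t"

lemma rhs_solution:
  obtains d where "d 1 = 0"
    "\<And>t. t \<in> {1..m + 1} \<Longrightarrow> (d has_real_derivative rhs \<beta> t (d t)) (at t within {1..m + 1})"
proof (rule picard_solution[of 1 "m + 1" 1 "rhs \<beta>" 0])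
  show "continuous_on ({1..m + 1} \<times> UNIV) (\<lambda>(t, y). rhs \<beta> t y)"
    unfolding rhs_def extended_slope_def p_fun_def case_prod_beta
    using extended_slope_denom
    by (intro continuous_intros) (auto simp: less_imp_neq[symmetric])
  show "\<bar>rhs \<beta> t x - rhs \<beta> t y\<bar> \<le> 1 * \<bar>x - y\<bar>" if "t \<in> {1..m + 1}" for t x y
    using extended_slope_lipschitz[of t x y] that by (simp add: rhs_def)
qed (use m_pos in auto)

lemma shooting:
  obtains \<beta> d where "\<beta> > 0" "d 1 = 0" "d (m + 1) = 0"
    "\<And>t. t \<in> {1..m + 1} \<Longrightarrow> (d has_real_derivative rhs \<beta> t (d t)) (at t within {1..m + 1})"
proof -
  obtain d where d1: "\<And>\<beta>. d \<beta> 1 = 0"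
    and d': "\<And>\<beta> t. t \<in> {1..m + 1} \<Longrightarrow>
      (d \<beta> has_real_derivative rhs \<beta> t (d \<beta> t)) (at t within {1..m + 1})"
  proof -
    have "\<forall>\<beta>. \<exists>d. d 1 = 0 \<and> (\<forall>t\<in>{1..m + 1}. (d has_real_derivative rhs \<beta> t (d t)) (at t within {1..m + 1}))"
      using rhs_solution by metis
    then show ?thesis
      using that by metis
  qed
  define a where "a \<beta> t = extended_slope t (d \<beta> t)" for \<beta> t
  have a_cont: "continuous_on {1..m + 1} (a \<beta>)" for \<beta>
  proof -
    have "continuous_on {1..m + 1} (d \<beta>)"
      using DERIV_continuous_on[OF d'] .
    then show ?thesis
      unfolding a_def extended_slope_def using extended_slope_denom
      by (intro continuous_intros) (auto simp: less_imp_neq[symmetric])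
  qed
  have a_pos: "a \<beta> t > 0" if "t \<in> {1..m + 1}" for \<beta> t
    using that by (simp add: a_def extended_slope_pos)
  note d_lin = d'[unfolded rhs_def, folded a_def]
  \<comment> \<open>The constant of \<open>solution_difference_bound\<close> on an interval of
    length \<open>m\<close> with \<open>L = 1\<close>, where \<open>2 * (m + 1)\<close> bounds the
    change of \<open>p t\<close> per unit of \<open>\<beta>\<close>.\<close>
  define K where "K = (2 * (m + 1))\<^sup>2 * (m * exp (3 * m))"
  have close: "\<bar>d \<beta>1 (m + 1) - d \<beta>2 (m + 1)\<bar> \<le> sqrt K * \<bar>\<beta>1 - \<beta>2\<bar>" for \<beta>1 \<beta>2
  proof -
    define \<delta> where "\<delta> = 2 * (m + 1) * \<bar>\<beta>1 - \<beta>2\<bar>"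
    have "(d \<beta>1 (m + 1) - d \<beta>2 (m + 1))\<^sup>2 \<le> \<delta>\<^sup>2 * ((m + 1 - 1) * exp ((2 * 1 + 1) * (m + 1 - 1)))"
    proof (rule solution_difference_bound[where f = "rhs \<beta>1" and g = "rhs \<beta>2"])
      show "\<bar>rhs \<beta>1 t x - rhs \<beta>1 t y\<bar> \<le> 1 * \<bar>x - y\<bar>" if "t \<in> {1..m + 1}" for t x y
        using extended_slope_lipschitz[of t x y] that by (simp add: rhs_def)
      show "\<bar>rhs \<beta>1 t x - rhs \<beta>2 t x\<bar> \<le> \<delta>" if "t \<in> {1..m + 1}" for t x
      proof -
        have t: "1 \<le> t\<^sup>2" "t\<^sup>2 \<le> (m + 1)\<^sup>2"
          using that by (auto intro: power_mono one_le_power)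
        define q where "q = (t\<^sup>2 - 1) / (m * (m + 2)) * t"
        have "(t\<^sup>2 - 1) / (m * (m + 2)) \<le> 1" "0 \<le> (t\<^sup>2 - 1) / (m * (m + 2))"
          using t denom_pos endpoint_square by (simp_all add: pos_divide_le_eq)
        then have q: "0 \<le> q" "q \<le> 1 * (m + 1)"
          using that unfolding q_def by (intro mult_nonneg_nonneg mult_mono; simp)+
        have "rhs \<beta>1 t x - rhs \<beta>2 t x = 2 * q * (\<beta>2 - \<beta>1)"
          using p_diff[of \<beta>1 t \<beta>2] by (simp add: rhs_def q_def left_diff_distrib[symmetric])
        then have "\<bar>rhs \<beta>1 t x - rhs \<beta>2 t x\<bar> = 2 * q * \<bar>\<beta>1 - \<beta>2\<bar>"
          using q by (simp add: abs_mult abs_minus_commute)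
        also have "\<dots> \<le> \<delta>"
          using q unfolding \<delta>_def by (intro mult_right_mono) auto
        finally show ?thesis .
      qed
    qed (use m_pos d1 d' in auto)
    also have "\<dots> = K * \<bar>\<beta>1 - \<beta>2\<bar>\<^sup>2"
      by (simp only: K_def \<delta>_def power_mult_distrib) (simp add: mult_ac)
    finally have "sqrt ((d \<beta>1 (m + 1) - d \<beta>2 (m + 1))\<^sup>2) \<le> sqrt (K * \<bar>\<beta>1 - \<beta>2\<bar>\<^sup>2)"
      by (rule real_sqrt_le_mono)
    then show ?thesis
      by (simp add: real_sqrt_mult)
  qed
  have "(sqrt K)-lipschitz_on {b0..b0 * (m + 1)} (\<lambda>\<beta>. d \<beta> (m + 1))"
    using close m_pos by (intro lipschitz_onI) (auto simp: dist_real_def K_def)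
  then have "continuous_on {b0..b0 * (m + 1)} (\<lambda>\<beta>. d \<beta> (m + 1))"
    by (rule lipschitz_on_continuous_on)
  \<comment> \<open>A nonpositive value would give \<open>b0 > b0\<close>.\<close>
  moreover have "0 \<le> d b0 (m + 1)"
    using linear_beta_greater[OF b0_pos a_cont a_pos d1 d_lin] by force
  moreover have "d (b0 * (m + 1)) (m + 1) \<le> 0"
    using b0_pos m_pos extended_slope_le
    by (intro less_imp_le[OF linear_end_negative[OF _ a_cont a_pos d1 d_lin]]) (auto simp: a_def)
  moreover have "b0 \<le> b0 * (m + 1)"
    using b0_pos m_pos by simp
  ultimately obtain \<beta> where "\<beta> \<ge> b0" "d \<beta> (m + 1) = 0"
    using IVT2'[of "\<lambda>\<beta>. d \<beta> (m + 1)" "b0 * (m + 1)" 0 b0] by blast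
  then show ?thesis
    using that[of \<beta> "d \<beta>"] b0_pos d1 d' by auto
qed

lemma solution_exists:
  obtains \<beta> v where "\<beta> > 0" "smooth_bvp_solution m b0 \<beta> v"
proof -
  obtain \<beta> d where \<beta>: "\<beta> > 0" and d: "d 1 = 0" "d (m + 1) = 0"
    and d': "\<And>t. t \<in> {1..m + 1} \<Longrightarrow> (d has_real_derivative rhs \<beta> t (d t)) (at t within {1..m + 1})"
    using shooting by blast
  define a where "a t = extended_slope t (d t)" for t
  have a_cont: "continuous_on {1..m + 1} a"
    unfolding a_def extended_slope_def using extended_slope_denom DERIV_continuous_on[OF d']
    by (intro continuous_intros) (auto simp: less_imp_neq[symmetric])
  have a_pos: "a t > 0" if "t \<in> {1..m + 1}" for t
    using that by (simp add: a_def extended_slope_pos)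
  \<comment> \<open>Positivity places the solution where the extended equation coincides with the
    original one.\<close>
  have d_nonneg: "d t \<ge> 0" if "t \<in> {1..m + 1}" for t
  proof (cases "t \<in> {1<..<m + 1}")
    case True
    then show ?thesis
      using linear_positive[OF \<beta> a_cont a_pos d(1) d'[unfolded rhs_def, folded a_def] d(2)]
      by (simp add: less_imp_le)
  next
    case False
    then have "t = 1 \<or> t = m + 1"
      using that by auto
    then show ?thesis
      using d by auto
  qed
  define v where "v t = 2 * t\<^sup>2 + d t" for t
  have v_pos: "v t > 0" if "t \<in> {1..m + 1}" for t
    using d_nonneg[OF that] that unfolding v_def by (intro add_pos_nonneg) auto
  have v': "(v has_real_derivative 2 * sqrt 2 * sqrt (v t) + p \<beta> t * t) (at t within {1..m + 1})"
    if t: "t \<in> {1..m + 1}" for t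
  proof -
    have "extended_slope t (d t) * d t = 2 * sqrt 2 * (sqrt (v t) - sqrt 2 * t)"
      using t d_nonneg[OF t] by (simp add: extended_slope_mult v_def)
    then have "rhs \<beta> t (d t) + 4 * t = 2 * sqrt 2 * sqrt (v t) + p \<beta> t * t"
      by (simp add: rhs_def algebra_simps)
    moreover have "(v has_real_derivative rhs \<beta> t (d t) + 4 * t) (at t within {1..m + 1})"
      unfolding v_def by (auto intro!: derivative_eq_intros d'[OF t])
    ultimately show ?thesis by metis
  qed
  have "smooth_on_set v {1..m + 1}"
  proof (rule smooth_on_set_sqrt_ode[OF v_pos])
    \<comment> \<open>The coefficients of \<open>p \<beta> t * t\<close> as a polynomial in
      \<open>t\<close>.\<close>
    let ?q = "[:0, coeff_C m b0 \<beta>, 0, coeff_B m b0 \<beta> / 2:]"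
    show "(v has_real_derivative 2 * sqrt 2 * sqrt (v t) + poly ?q t) (at t within {1..m + 1})"
      if "t \<in> {1..m + 1}" for t
      by (rule DERIV_cong[OF v'[OF that]]) (simp add: p_fun_def algebra_simps power2_eq_square)
  qed auto
  then have "smooth_bvp_solution m b0 \<beta> v"
    using v_pos v' d by (auto simp: smooth_bvp_solution_def v_def less_imp_le)
  with \<beta> show ?thesis
    using that by blast
qed

end

theorem theorem3p2p1:
  fixes m \<beta>0 :: real
  assumes "m > 0" and "\<beta>0 > 0"
  shows "\<exists>\<beta>inf > 0.
           (\<forall>\<beta> > 0. (\<exists>v. smooth_bvp_solution m \<beta>0 \<beta> v) \<longleftrightarrow> \<beta> = \<beta>inf) \<and>
           \<beta>inf > \<beta>0 \<and>
           coeff_B m \<beta>0 \<beta>inf < 0 \<and>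
           coeff_C m \<beta>0 \<beta>inf > 0 \<and>
           (\<exists>v. smooth_bvp_solution m \<beta>0 \<beta>inf v \<and>
                (\<forall>w. smooth_bvp_solution m \<beta>0 \<beta>inf w \<longrightarrow>
                     (\<forall>\<gamma>\<in>{1..m + 1}. w \<gamma> = v \<gamma>)) \<and>
                (v has_real_derivative 2 * (\<beta>0 + 2)) (at 1 within {1..m + 1}) \<and>
                (v has_real_derivative - 2 * (m + 1) * (\<beta>inf - 2))
                  (at (m + 1) within {1..m + 1}) \<and>
                (\<forall>\<gamma>\<in>{1<..<m + 1}. v \<gamma> > 2 * \<gamma>\<^sup>2))"
proof -
  interpret bvp_parameters m \<beta>0
    using assms by unfold_locales
  obtain b v where b: "b > 0" and v: "smooth_bvp_solution m \<beta>0 b v"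
    using solution_exists by blast
  \<comment> \<open>The comparison requires ordered parameters, so both orders are supplied.\<close>
  have unique_b: "\<beta> = b" if "\<beta> > 0" "smooth_bvp_solution m \<beta>0 \<beta> w" for \<beta> w
    using solution_compare(1)[of \<beta> b w v] solution_compare(1)[of b \<beta> v w] that b v by linarith
  have unique_v: "w t = v t" if "smooth_bvp_solution m \<beta>0 b w" "t \<in> {1..m + 1}" for w t
    using solution_compare(2)[OF b order_refl v that(1)] solution_compare(2)[OF b order_refl that(1) v]
      that(2) by (simp add: antisym)
  have v': "(v has_real_derivative 2 * sqrt 2 * sqrt (v t) + p b t * t) (at t within {1..m + 1})"
    if "t \<in> {1..m + 1}" for t
    using v that by (simp add: smooth_bvp_solution_def)
  have ends: "v 1 = 2" "v (m + 1) = 2 * (m + 1)\<^sup>2"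
    using v by (auto simp: smooth_bvp_solution_def)
  have "coeff_B m \<beta>0 b < 0" "coeff_C m \<beta>0 b > 0"
    using assms b by (auto simp: coeff_B_def coeff_C_def intro!: divide_neg_pos divide_pos_pos add_nonneg_pos)
  moreover have "(v has_real_derivative 2 * (\<beta>0 + 2)) (at 1 within {1..m + 1})"
    by (rule DERIV_cong[OF v']) (use assms in \<open>auto simp: ends p_at_1\<close>)
  moreover have "(v has_real_derivative - 2 * (m + 1) * (b - 2)) (at (m + 1) within {1..m + 1})"
  proof (rule DERIV_cong[OF v'])
    have "sqrt (v (m + 1)) = sqrt 2 * (m + 1)"
      using assms by (simp add: ends real_sqrt_mult)
    then show "2 * sqrt 2 * sqrt (v (m + 1)) + p b (m + 1) * (m + 1) = - 2 * (m + 1) * (b - 2)"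
      unfolding p_at_end by (simp add: algebra_simps)
  qed (use assms in auto)
  moreover have "\<forall>\<beta>>0. (\<exists>w. smooth_bvp_solution m \<beta>0 \<beta> w) \<longleftrightarrow> \<beta> = b"
    using unique_b v by blast
  moreover have "b > \<beta>0" "\<forall>t\<in>{1<..<m + 1}. v t > 2 * t\<^sup>2"
    using solution_bound(1,2)[OF b v] by blast+
  ultimately show ?thesis
    using b v unique_v by blast
qed

end
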